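(* Let $\alpha\ge3$ and $\mathbf{u}^0\in\mathcal{A}$ be fixed. There is a constant $C>0$, independent of $s$ and $N$, such that for every $s>0$, the sequence $\{\mathbf{u}^n\}_{n\in\mathbb{N}}$ generated with step size $s$ by the BDF-2 accelerated gradient flow algorithm described in the context satisfies, for every integer $N\ge1$, $$\|B(\mathbf{u}^N,\mathbf{u}^N)-\mathbf{u}_c\|_Z\le C\,s^2 .$$
   Context: Setting. $\Omega\subset\mathbb{R}^d$ is a bounded Lipschitz domain; $U$ is a real Hilbert space of functions $\Omega\to\mathbb{R}^m$ continuously embedded in $H^1(\Omega;\mathbb{R}^m)$; $U_D\subset U$ is the set of functions satisfying given Dirichlet conditions on $\Gamma_D\subset\partial\Omega$ and $U_0\subset U$ is the closed linear subspace of functions satisfying the corresponding homogeneous conditions. $Z$ is a normed function space on $\Omega$, $B:U\times U\to Z$ is symmetric bilinear with $\|B(\mathbf{v},\mathbf{v})\|_Z\le c_Z\|\mathbf{v}\|_U^2$, and $\mathbf{u}_c\in Z$. $\mathcal{M}:U\times U\to\mathbb{R}$ is symmetric bilinear with $\mathcal{M}(\mathbf{v},\mathbf{v})\ge C_1\|\mathbf{v}\|_U^2$ and $\mathcal{M}(\mathbf{v},\mathbf{w})\le C_2\|\mathbf{v}\|_U\|\mathbf{w}\|_U$ on $U$ ($C_1,C_2>0$). $\mathcal{A}=\{\mathbf{u}\in U_D:B(\mathbf{u},\mathbf{u})=\mathbf{u}_c\}$ and $\mathcal{F}_{\mathbf{u}}=\{\mathbf{v}\in U_0:B(\mathbf{u},\mathbf{v})=0\}$.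 Algorithm (BDF-2 accelerated flow; infinite sequence, no stopping). Given $\alpha\ge3$, $s>0$, $t_n=ns$, $\mathbf{u}^0\in\mathcal{A}$. Step 1: with $d_t\mathbf{u}^0=\mathbf{0}$ and $d_t^2\mathbf{u}^1=(d_t\mathbf{u}^1-d_t\mathbf{u}^0)/s$, find $d_t\mathbf{u}^1\in\mathcal{F}_{\mathbf{u}^0}$ with $(d_t^2\mathbf{u}^1,\mathbf{w})_U+\frac{\alpha}{s}(d_t\mathbf{u}^1,\mathbf{w})_U+\mathcal{M}(\mathbf{u}^0+s\,d_t\mathbf{u}^1,\mathbf{w})=0$ for all $\mathbf{w}\in\mathcal{F}_{\mathbf{u}^0}$; set $\mathbf{u}^1=\mathbf{u}^0+s\,d_t\mathbf{u}^1$. Step 2: with $\hat{\mathbf{u}}^2=2\mathbf{u}^1-\mathbf{u}^0$, find $\dot{\mathbf{u}}^2\in\mathcal{F}_{\hat{\mathbf{u}}^2}$ with $(\frac{\dot{\mathbf{u}}^2-d_t\mathbf{u}^1}{s},\mathbf{w})_U+\frac{\alpha}{2s}(\dot{\mathbf{u}}^2,\mathbf{w})_U+\frac13\mathcal{M}(4\mathbf{u}^1-\mathbf{u}^0+2s\dot{\mathbf{u}}^2,\mathbf{w})=0$ for all $\mathbf{w}\in\mathcal{F}_{\hat{\mathbf{u}}^2}$; set $\mathbf{u}^2=(4\mathbf{u}^1-\mathbf{u}^0+2s\dot{\mathbf{u}}^2)/3$. Step $n\ge3$: with $\hat{\mathbf{u}}^n=2\mathbf{u}^{n-1}-\mathbf{u}^{n-2}$,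 find $\dot{\mathbf{u}}^n\in\mathcal{F}_{\hat{\mathbf{u}}^n}$ with $(\frac{\dot{\mathbf{u}}^n-\dot{\mathbf{u}}^{n-1}}{s},\mathbf{w})_U+\frac{\alpha}{t_n}(\dot{\mathbf{u}}^n,\mathbf{w})_U+\frac13\mathcal{M}(4\mathbf{u}^{n-1}-\mathbf{u}^{n-2}+2s\dot{\mathbf{u}}^n,\mathbf{w})=0$ for all $\mathbf{w}\in\mathcal{F}_{\hat{\mathbf{u}}^n}$; set $\mathbf{u}^n=(4\mathbf{u}^{n-1}-\mathbf{u}^{n-2}+2s\dot{\mathbf{u}}^n)/3$. *)

theory Defs
  imports "HOL-Analysis.Analysis"
begin

section \<open>Bounded Lipschitz domains\<close>

text \<open>The boundary is locally the graph of a Lipschitz function over the hyperplane orthogonal to a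
  unit vector \<open>e\<close>, with the domain on one side of the graph.\<close>

definition bounded_lipschitz_domain :: "(real ^ 'd) set \<Rightarrow> bool" where
  "bounded_lipschitz_domain \<Omega> \<longleftrightarrow>
     open \<Omega> \<and> connected \<Omega> \<and> \<Omega> \<noteq> {} \<and> bounded \<Omega> \<and>
     (\<forall>x \<in> frontier \<Omega>. \<exists>r > 0. \<exists>e L (\<gamma> :: real ^ 'd \<Rightarrow> real).
        norm e = 1 \<and> L-lipschitz_on {y. y \<bullet> e = 0} \<gamma> \<and>
        \<Omega> \<inter> ball x r = {y \<in> ball x r. y \<bullet> e > \<gamma> (y - (y \<bullet> e) *\<^sub>R e)})"


section \<open>The Sobolev space of order one\<close>

primrec continuously_differentiable :: "nat \<Rightarrow> (real ^ 'd \<Rightarrow> real) \<Rightarrow> bool" where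
  "continuously_differentiable 0 \<phi> \<longleftrightarrow> continuous_on UNIV \<phi>"
| "continuously_differentiable (Suc k) \<phi> \<longleftrightarrow>
     (\<forall>x. \<phi> differentiable (at x)) \<and>
     (\<forall>i. continuously_differentiable k (\<lambda>x. frechet_derivative \<phi> (at x) (axis i 1)))"

definition test_function :: "(real ^ 'd) set \<Rightarrow> (real ^ 'd \<Rightarrow> real) \<Rightarrow> bool" where
  "test_function \<Omega> \<phi> \<longleftrightarrow>
     (\<forall>k. continuously_differentiable k \<phi>) \<and>
     compact (closure {x. \<phi> x \<noteq> 0}) \<and> closure {x. \<phi> x \<noteq> 0} \<subseteq> \<Omega>"

definition square_integrable_on :: "(real ^ 'd) set \<Rightarrow> (real ^ 'd \<Rightarrow> 'e :: euclidean_space) \<Rightarrow> bool" where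
  "square_integrable_on \<Omega> f \<longleftrightarrow>
     f \<in> borel_measurable (lebesgue_on \<Omega>) \<and> integrable (lebesgue_on \<Omega>) (\<lambda>x. (norm (f x))\<^sup>2)"

definition weak_gradient ::
  "(real ^ 'd) set \<Rightarrow> (real ^ 'd \<Rightarrow> real ^ 'm) \<Rightarrow> ('d \<Rightarrow> real ^ 'd \<Rightarrow> real ^ 'm) \<Rightarrow> bool" where
  "weak_gradient \<Omega> f G \<longleftrightarrow>
     (\<forall>i. square_integrable_on \<Omega> (G i) \<and>
        (\<forall>\<phi>. test_function \<Omega> \<phi> \<longrightarrow>
           (LINT x|lebesgue_on \<Omega>. frechet_derivative \<phi> (at x) (axis i 1) *\<^sub>R f x) =
           - (LINT x|lebesgue_on \<Omega>. \<phi> x *\<^sub>R G i x)))"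

definition in_H1 :: "(real ^ 'd) set \<Rightarrow> (real ^ 'd \<Rightarrow> real ^ 'm) \<Rightarrow> bool" where
  "in_H1 \<Omega> f \<longleftrightarrow> square_integrable_on \<Omega> f \<and> (\<exists>G. weak_gradient \<Omega> f G)"

text \<open>On an open set the weak gradient is unique almost everywhere, so the norm does not depend on
  the choice below.\<close>

definition H1_norm :: "(real ^ 'd) set \<Rightarrow> (real ^ 'd \<Rightarrow> real ^ 'm) \<Rightarrow> real" where
  "H1_norm \<Omega> f =
     (let G = (SOME G. weak_gradient \<Omega> f G) in
      sqrt ((LINT x|lebesgue_on \<Omega>. (norm (f x))\<^sup>2) +
            (\<Sum>i\<in>UNIV. LINT x|lebesgue_on \<Omega>. (norm (G i x))\<^sup>2)))"


section \<open>Function spaces\<close>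

text \<open>A space of functions on \<open>\<Omega>\<close>, taken modulo equality almost everywhere, is a vector space
  type \<open>'a\<close> (whose type class supplies the norm or inner product) together with a map \<open>rep\<close> that
  selects a representative function for each element. Values of \<open>rep v\<close> outside \<open>\<Omega>\<close> are
  irrelevant.\<close>

definition function_space_on ::
  "(real ^ 'd) set \<Rightarrow> ('a :: real_vector \<Rightarrow> real ^ 'd \<Rightarrow> 'e :: euclidean_space) \<Rightarrow> bool" where
  "function_space_on \<Omega> rep \<longleftrightarrow>
     (\<forall>v. rep v \<in> borel_measurable (lebesgue_on \<Omega>)) \<and>
     (\<forall>v w. AE x in lebesgue_on \<Omega>. rep (v + w) x = rep v x + rep w x) \<and>
     (\<forall>c v. AE x in lebesgue_on \<Omega>. rep (c *\<^sub>R v) x = c *\<^sub>R rep v x) \<and>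
     (\<forall>v w. (AE x in lebesgue_on \<Omega>. rep v x = rep w x) \<longrightarrow> v = w)"

definition continuously_embedded_in_H1 ::
  "(real ^ 'd) set \<Rightarrow> ('u :: real_normed_vector \<Rightarrow> real ^ 'd \<Rightarrow> real ^ 'm) \<Rightarrow> bool" where
  "continuously_embedded_in_H1 \<Omega> rep \<longleftrightarrow>
     function_space_on \<Omega> rep \<and> (\<forall>v. in_H1 \<Omega> (rep v)) \<and>
     (\<exists>K. \<forall>v. H1_norm \<Omega> (rep v) \<le> K * norm v)"

text \<open>Dirichlet conditions on \<open>\<Gamma>\<close> have the form \<open>T v = g\<close> for a linear operator \<open>T\<close> into a space of
  boundary data (for instance the trace on \<open>\<Gamma>\<close>, or the trace together with the trace of the
  gradient). The kernel of \<open>T\<close> is closed, and \<open>T\<close> only sees the behaviour of functions near \<open>\<Gamma>\<close>.\<close>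

definition dirichlet_operator ::
  "(real ^ 'd) set \<Rightarrow> (real ^ 'd) set \<Rightarrow> ('u :: real_normed_vector \<Rightarrow> real ^ 'd \<Rightarrow> real ^ 'm) \<Rightarrow>
   ('u \<Rightarrow> 'b :: real_vector) \<Rightarrow> bool" where
  "dirichlet_operator \<Omega> \<Gamma> rep T \<longleftrightarrow>
     linear T \<and> closed {v. T v = 0} \<and>
     (\<forall>v W. open W \<and> \<Gamma> \<subseteq> W \<and> (AE x in lebesgue_on (\<Omega> \<inter> W). rep v x = 0) \<longrightarrow> T v = 0)"


section \<open>Constraint and algorithm\<close>

definition symmetric_bilinear :: "('u :: real_vector \<Rightarrow> 'u \<Rightarrow> 'z :: real_vector) \<Rightarrow> bool" where
  "symmetric_bilinear b \<longleftrightarrow> bilinear b \<and> (\<forall>v w. b v w = b w v)"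

definition admissible_set :: "'u set \<Rightarrow> ('u \<Rightarrow> 'u \<Rightarrow> 'z) \<Rightarrow> 'z \<Rightarrow> 'u set" where
  "admissible_set UD B uc = {u \<in> UD. B u u = uc}"

definition tangent_space :: "'u set \<Rightarrow> ('u \<Rightarrow> 'u \<Rightarrow> 'z :: zero) \<Rightarrow> 'u \<Rightarrow> 'u set" where
  "tangent_space U0 B u = {v \<in> U0. B u v = 0}"

text \<open>\<open>d1\<close> is the first velocity (the backward difference quotient at time \<open>s\<close>) and \<open>ud n\<close>, for
  \<open>n \<ge> 2\<close>, is the BDF-2 velocity at time \<open>n s\<close>; \<open>ud 0\<close> and \<open>ud 1\<close> are not used.\<close>

definition bdf2_accelerated_flow ::
  "'u set \<Rightarrow> ('u :: real_inner \<Rightarrow> 'u \<Rightarrow> 'z :: zero) \<Rightarrow> ('u \<Rightarrow> 'u \<Rightarrow> real) \<Rightarrow> real \<Rightarrow> real \<Rightarrow> 'u \<Rightarrow>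
   (nat \<Rightarrow> 'u) \<Rightarrow> bool" where
  "bdf2_accelerated_flow U0 B M \<alpha> s u_init u \<longleftrightarrow>
     u 0 = u_init \<and>
     (\<exists>d1 ud.
        (let d0 = 0; dd1 = (d1 - d0) /\<^sub>R s in
           d1 \<in> tangent_space U0 B (u 0) \<and>
           (\<forall>w \<in> tangent_space U0 B (u 0).
              dd1 \<bullet> w + \<alpha> / s * (d1 \<bullet> w) + M (u 0 + s *\<^sub>R d1) w = 0) \<and>
           u 1 = u 0 + s *\<^sub>R d1) \<and>
        (let uh = 2 *\<^sub>R u 1 - u 0 in
           ud 2 \<in> tangent_space U0 B uh \<and>
           (\<forall>w \<in> tangent_space U0 B uh.
              ((ud 2 - d1) /\<^sub>R s) \<bullet> w + \<alpha> / (2 * s) * (ud 2 \<bullet> w)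
              + 1 / 3 * M (4 *\<^sub>R u 1 - u 0 + (2 * s) *\<^sub>R ud 2) w = 0) \<and>
           u 2 = (4 *\<^sub>R u 1 - u 0 + (2 * s) *\<^sub>R ud 2) /\<^sub>R 3) \<and>
        (\<forall>n \<ge> 3. let uh = 2 *\<^sub>R u (n - 1) - u (n - 2); t = real n * s in
           ud n \<in> tangent_space U0 B uh \<and>
           (\<forall>w \<in> tangent_space U0 B uh.
              ((ud n - ud (n - 1)) /\<^sub>R s) \<bullet> w + \<alpha> / t * (ud n \<bullet> w)
              + 1 / 3 * M (4 *\<^sub>R u (n - 1) - u (n - 2) + (2 * s) *\<^sub>R ud n) w = 0) \<and>
           u n = (4 *\<^sub>R u (n - 1) - u (n - 2) + (2 * s) *\<^sub>R ud n) /\<^sub>R 3))"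

end

theory Submission
  imports Defs
begin

text \<open>The constraint defect \<open>q n = B (u n) (u n) - u\<^sub>c\<close> satisfies
  \<open>3 q n - 4 q (n - 1) + q (n - 2) = 3 B (\<delta> n) (\<delta> n)\<close>, where
  \<open>\<delta> n = u n - 2 u (n - 1) + u (n - 2)\<close>, because the BDF-2 velocity \<open>v n\<close> is tangential at the
  extrapolated point. Hence \<open>q n\<close> is controlled by the first step and by the sum of the
  \<open>(norm (\<delta> k))\<^sup>2\<close>. Testing the scheme with the velocity itself bounds the sum of
  \<open>(norm (v k - v (k - 1)))\<^sup>2\<close> uniformly in the step size, and \<open>2 s (v k - v (k - 1)) =
  3 \<delta> k - \<delta> (k - 1)\<close> turns this into a bound of order \<open>s\<^sup>2\<close> for the sum of the
  \<open>(norm (\<delta> k))\<^sup>2\<close>.\<close>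

section \<open>Symmetric bilinear forms on the BDF-2 stencil\<close>

lemma symmetric_bilinear_expand:
  assumes "symmetric_bilinear b"
  shows "b (x + y) z = b x z + b y z" "b x (y + z) = b x y + b x z"
    "b (x - y) z = b x z - b y z" "b x (y - z) = b x y - b x z"
    "b (c *\<^sub>R x) y = c *\<^sub>R b x y" "b x (c *\<^sub>R y) = c *\<^sub>R b x y"
  using assms unfolding symmetric_bilinear_def
  by (auto simp: bilinear_ladd bilinear_radd bilinear_lsub bilinear_rsub bilinear_lmul bilinear_rmul)

lemma symmetric_bilinear_commute: "symmetric_bilinear b \<Longrightarrow> b x y = b y x"
  by (simp add: symmetric_bilinear_def)

lemma scaleR_3_4:
  fixes x :: "'a :: real_vector"
  shows "3 *\<^sub>R x = x + x + x" "4 *\<^sub>R x = x + x + x + x"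
  using scaleR_add_left[of 2 1 x] scaleR_add_left[of 2 2 x] by (simp_all add: scaleR_2)

text \<open>The two sides differ by exactly twice the form in the hypothesis. In the scheme
  \<open>2 *\<^sub>R y - z\<close> is the extrapolated point and
  \<open>3 *\<^sub>R x - 4 *\<^sub>R y + z\<close> is \<open>2 * s\<close> times the velocity, so
  the hypothesis is the linearized constraint.\<close>

lemma bdf2_defect_identity:
  assumes b: "symmetric_bilinear b"
    and "b (2 *\<^sub>R y - z) (3 *\<^sub>R x - 4 *\<^sub>R y + z) = 0"
  shows "3 *\<^sub>R b x x - 4 *\<^sub>R b y y + b z z = 3 *\<^sub>R b (x - 2 *\<^sub>R y + z) (x - 2 *\<^sub>R y + z)"
proof -
  note comm = symmetric_bilinear_commute[OF b, of y x] symmetric_bilinear_commute[OF b, of z x]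
    symmetric_bilinear_commute[OF b, of z y]
  have "3 *\<^sub>R b x x - 4 *\<^sub>R b y y + b z z - 3 *\<^sub>R b (x - 2 *\<^sub>R y + z) (x - 2 *\<^sub>R y + z)
      = 2 *\<^sub>R b (2 *\<^sub>R y - z) (3 *\<^sub>R x - 4 *\<^sub>R y + z)"
    unfolding symmetric_bilinear_expand[OF b] comm by (simp add: scaleR_3_4 scaleR_2 algebra_simps)
  then show ?thesis
    using assms(2) by simp
qed

text \<open>This is the G-stability of BDF-2: tested with the newest value, the stencil is an
  increment of a two-step energy plus a square, which is nonnegative when \<open>b\<close>
  is.\<close>

lemma bdf2_energy_identity:
  fixes b :: "'u :: real_vector \<Rightarrow> 'u \<Rightarrow> real"
  assumes b: "symmetric_bilinear b"
  shows "2 * b x (3 *\<^sub>R x - 4 *\<^sub>R y + z) =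
    (b x x + b (2 *\<^sub>R x - y) (2 *\<^sub>R x - y)) - (b y y + b (2 *\<^sub>R y - z) (2 *\<^sub>R y - z))
    + b (x - 2 *\<^sub>R y + z) (x - 2 *\<^sub>R y + z)"
proof -
  note comm = symmetric_bilinear_commute[OF b, of y x] symmetric_bilinear_commute[OF b, of z x]
    symmetric_bilinear_commute[OF b, of z y]
  show ?thesis
    unfolding symmetric_bilinear_expand[OF b] comm by (simp add: algebra_simps)
qed

section \<open>Recurrences with contraction factor 1/3\<close>

lemma linear_recurrence_bound:
  fixes q :: "nat \<Rightarrow> 'a :: real_normed_vector"
  assumes "q 0 = 0" and D: "\<And>n. norm (3 *\<^sub>R q (Suc n) - q n) \<le> 2 * D"
  shows "norm (q n) \<le> D"
proof (induction n)
  case 0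
  show ?case
    using order_trans[OF norm_ge_zero D] by (simp add: \<open>q 0 = 0\<close>)
next
  case (Suc n)
  have "3 * norm (q (Suc n)) = norm ((3 *\<^sub>R q (Suc n) - q n) + q n)"
    by simp
  also have "\<dots> \<le> 2 * D + D"
    by (rule norm_triangle_mono[OF D Suc])
  finally show ?case
    by simp
qed

text \<open>By \<open>(a + b)^2 \<le> 2 a^2 + 2 b^2\<close> the recurrence bounds nine copies of the
  new square by the driving term and two copies of the old one. The term outside the sum carries two
  copies on to the next step, which leaves seven for the sum.\<close>

lemma sum_second_differences_bound:
  fixes \<delta> e :: "nat \<Rightarrow> 'a :: real_normed_vector"
  assumes "\<delta> 0 = 0" and rec: "\<And>n. (2 * s) *\<^sub>R e n = 3 *\<^sub>R \<delta> (Suc n) - \<delta> n"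
  shows "7 * (\<Sum>k<n. (norm (\<delta> (Suc k)))\<^sup>2) + 2 * (norm (\<delta> n))\<^sup>2
    \<le> 8 * s\<^sup>2 * (\<Sum>k<n. (norm (e k))\<^sup>2)"
proof (induction n)
  case 0
  show ?case
    by (simp add: \<open>\<delta> 0 = 0\<close>)
next
  case (Suc n)
  have "3 * norm (\<delta> (Suc n)) = norm ((2 * s) *\<^sub>R e n + \<delta> n)"
    by (simp add: rec)
  also have "\<dots> \<le> 2 * \<bar>s\<bar> * norm (e n) + norm (\<delta> n)"
    by (rule order_trans[OF norm_triangle_ineq]) (simp add: abs_mult)
  finally have "(3 * norm (\<delta> (Suc n)))\<^sup>2 \<le> (2 * \<bar>s\<bar> * norm (e n) + norm (\<delta> n))\<^sup>2"
    by (rule power_mono) simp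
  also have "\<dots> \<le> 8 * s\<^sup>2 * (norm (e n))\<^sup>2 + 2 * (norm (\<delta> n))\<^sup>2"
    using sum_squares_bound[of "2 * \<bar>s\<bar> * norm (e n)" "norm (\<delta> n)"]
    by (simp add: power2_sum power_mult_distrib)
  finally have "9 * (norm (\<delta> (Suc n)))\<^sup>2 \<le> 8 * s\<^sup>2 * (norm (e n))\<^sup>2 + 2 * (norm (\<delta> n))\<^sup>2"
    by (simp add: power_mult_distrib)
  with Suc show ?case
    by (simp add: algebra_simps)
qed

section \<open>Velocities: energy estimates and extraction from the scheme\<close>

text \<open>Testing the first step with \<open>d\<close> gives two nonnegative terms below
  \<open>C\<^sub>2 * norm u * norm d\<close>; each bound keeps one of them. Their product bounds
  \<open>(norm d)\<^sup>2\<close> uniformly in \<open>s\<close>, for small and large steps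
  alike.\<close>

lemma first_velocity_bounds:
  fixes M :: "'u :: real_inner \<Rightarrow> 'u \<Rightarrow> real"
  assumes M: "symmetric_bilinear M"
    and coercive: "C\<^sub>1 > 0" "\<And>v. M v v \<ge> C\<^sub>1 * (norm v)\<^sup>2"
    and bounded: "\<And>v w. M v w \<le> C\<^sub>2 * norm v * norm w"
    and "C\<^sub>2 > 0" "\<alpha> \<ge> 0" and s: "s > 0"
    and eq: "(d /\<^sub>R s) \<bullet> d + \<alpha> / s * (d \<bullet> d) + M (u + s *\<^sub>R d) d = 0"
  shows "norm d \<le> C\<^sub>2 * norm u * s" "s * norm d \<le> C\<^sub>2 * norm u / C\<^sub>1"
proof -
  \<comment> \<open>Boundedness of \<open>M\<close> is one-sided, hence its use at
    \<open>-u\<close>.\<close>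
  have "- M u d \<le> C\<^sub>2 * norm u * norm d"
    using bounded[of "(-1) *\<^sub>R u" d] symmetric_bilinear_expand(5)[OF M, of "-1" u d] by simp
  moreover have "s * M d d \<ge> s * (C\<^sub>1 * (norm d)\<^sup>2)"
    using coercive s by simp
  moreover have "\<alpha> / s * (norm d)\<^sup>2 \<ge> 0"
    using \<open>\<alpha> \<ge> 0\<close> s by simp
  ultimately have *: "(norm d)\<^sup>2 / s + s * (C\<^sub>1 * (norm d)\<^sup>2) \<le> C\<^sub>2 * norm u * norm d"
    using eq by (simp add: symmetric_bilinear_expand[OF M] dot_square_norm divide_inverse mult.commute)
  have pos: "(norm d)\<^sup>2 / s \<ge> 0" "s * (C\<^sub>1 * (norm d)\<^sup>2) \<ge> 0" "C\<^sub>2 * norm u \<ge> 0"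
    using s \<open>C\<^sub>1 > 0\<close> \<open>C\<^sub>2 > 0\<close> by simp_all
  have "norm d \<le> C\<^sub>2 * norm u * s \<and> s * norm d \<le> C\<^sub>2 * norm u / C\<^sub>1"
  proof (cases "d = 0")
    case True
    then show ?thesis
      using pos s \<open>C\<^sub>1 > 0\<close> by simp
  next
    case False
    have "norm d * (norm d / s) \<le> norm d * (C\<^sub>2 * norm u)"
      "norm d * (s * C\<^sub>1 * norm d) \<le> norm d * (C\<^sub>2 * norm u)"
      using * pos by (simp_all add: power2_eq_square mult_ac)
    from this[THEN mult_left_le_imp_le] False
    have "norm d / s \<le> C\<^sub>2 * norm u" "s * C\<^sub>1 * norm d \<le> C\<^sub>2 * norm u"
      by simp_all
    then show ?thesis
      using s \<open>C\<^sub>1 > 0\<close> by (simp add: field_simps)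
  qed
  then show "norm d \<le> C\<^sub>2 * norm u * s" "s * norm d \<le> C\<^sub>2 * norm u / C\<^sub>1"
    by simp_all
qed

text \<open>The kinetic part \<open>(norm (v n))\<^sup>2\<close> plus half the two-step energy of
  \<open>M\<close> decreases in each step by at least the squared velocity increment, since the
  damping \<open>a n\<close> has the favourable sign. Summation telescopes, and only the starting
  energy remains.\<close>

lemma bdf2_velocity_energy_estimate:
  fixes M :: "'u :: real_inner \<Rightarrow> 'u \<Rightarrow> real" and u v :: "nat \<Rightarrow> 'u"
  assumes M: "symmetric_bilinear M" and M_nonneg: "\<And>x. M x x \<ge> 0"
    and s: "s > 0" and a: "\<And>n. a n \<ge> 0"
    and vel: "\<And>n. (2 * s) *\<^sub>R v (Suc n) = 3 *\<^sub>R u (n + 2) - 4 *\<^sub>R u (n + 1) + u n"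
    and eq: "\<And>n. ((v (Suc n) - v n) /\<^sub>R s) \<bullet> v (Suc n) + a n * (v (Suc n) \<bullet> v (Suc n))
      + M (u (n + 2)) (v (Suc n)) = 0"
  shows "(\<Sum>k<n. (norm (v (Suc k) - v k))\<^sup>2)
    \<le> (norm (v 0))\<^sup>2 + (M (u 1) (u 1) + M (2 *\<^sub>R u 1 - u 0) (2 *\<^sub>R u 1 - u 0)) / 2"
proof -
  define G where "G n = M (u (n + 1)) (u (n + 1))
    + M (2 *\<^sub>R u (n + 1) - u n) (2 *\<^sub>R u (n + 1) - u n)" for n
  have step: "(norm (v (Suc n) - v n))\<^sup>2 + ((norm (v (Suc n)))\<^sup>2 + G (Suc n) / 2)
      \<le> (norm (v n))\<^sup>2 + G n / 2" for n
  proof -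
    let ?d = "u (n + 2) - 2 *\<^sub>R u (n + 1) + u n"
    have "4 * s * M (u (n + 2)) (v (Suc n)) = G (Suc n) - G n + M ?d ?d"
      using bdf2_energy_identity[OF M, of "u (n + 2)" "u (n + 1)" "u n", folded vel]
      by (simp add: symmetric_bilinear_expand(6)[OF M] G_def)
    then have "2 * (s * M (u (n + 2)) (v (Suc n))) \<ge> G (Suc n) / 2 - G n / 2"
      using M_nonneg[of ?d] by simp
    moreover have "2 * ((v (Suc n) - v n) \<bullet> v (Suc n)) =
        (norm (v (Suc n) - v n))\<^sup>2 + (norm (v (Suc n)))\<^sup>2 - (norm (v n))\<^sup>2"
      by (simp add: power2_norm_eq_inner inner_diff_left inner_diff_right inner_commute)
    moreover have "(v (Suc n) - v n) \<bullet> v (Suc n) \<le> - (s * M (u (n + 2)) (v (Suc n)))"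
    proof -
      have "(v (Suc n) - v n) \<bullet> v (Suc n) = s * (((v (Suc n) - v n) /\<^sub>R s) \<bullet> v (Suc n))"
        using s by simp
      also have "((v (Suc n) - v n) /\<^sub>R s) \<bullet> v (Suc n) \<le> - M (u (n + 2)) (v (Suc n))"
        using eq[of n] mult_nonneg_nonneg[OF a[of n] inner_ge_zero[of "v (Suc n)"]] by linarith
      finally show ?thesis
        using s by simp
    qed
    ultimately show ?thesis
      by linarith
  qed
  have G_nonneg: "G n \<ge> 0" for n
    by (simp add: G_def M_nonneg)
  have "(\<Sum>k<n. (norm (v (Suc k) - v k))\<^sup>2) + ((norm (v n))\<^sup>2 + G n / 2)
      \<le> (norm (v 0))\<^sup>2 + G 0 / 2"
  proof (induction n)
    case (Suc n)
    then show ?case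
      using step[of n] by simp
  qed simp
  then have "(\<Sum>k<n. (norm (v (Suc k) - v k))\<^sup>2) \<le> (norm (v 0))\<^sup>2 + G 0 / 2"
    using G_nonneg[of n] zero_le_power2[of "norm (v n)"] by linarith
  then show ?thesis
    by (simp add: G_def)
qed

text \<open>The velocity sequence extends the BDF-2 velocities by the first difference quotient, and its
  index is shifted by one: \<open>v n\<close> belongs to time \<open>(n + 1) s\<close>.\<close>

lemma bdf2_accelerated_flow_velocity:
  fixes B :: "'u :: real_inner \<Rightarrow> 'u \<Rightarrow> 'z :: zero"
  assumes flow: "bdf2_accelerated_flow U\<^sub>0 B M \<alpha> s u_init u" and M: "symmetric_bilinear M"
  obtains v where
    "u 0 = u_init" "B u_init (v 0) = 0" "u 1 = u_init + s *\<^sub>R v 0"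
    "(v 0 /\<^sub>R s) \<bullet> v 0 + \<alpha> / s * (v 0 \<bullet> v 0) + M (u_init + s *\<^sub>R v 0) (v 0) = 0"
    "\<And>n. B (2 *\<^sub>R u (n + 1) - u n) (v (Suc n)) = 0"
    "\<And>n. (2 * s) *\<^sub>R v (Suc n) = 3 *\<^sub>R u (n + 2) - 4 *\<^sub>R u (n + 1) + u n"
    "\<And>n. ((v (Suc n) - v n) /\<^sub>R s) \<bullet> v (Suc n) + \<alpha> / (real (n + 2) * s) * (v (Suc n) \<bullet> v (Suc n))
      + M (u (n + 2)) (v (Suc n)) = 0"
proof -
  obtain d ud where u0: "u 0 = u_init"
    and first: "d \<in> tangent_space U\<^sub>0 B (u 0)"
      "\<forall>w \<in> tangent_space U\<^sub>0 B (u 0).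
         (d /\<^sub>R s) \<bullet> w + \<alpha> / s * (d \<bullet> w) + M (u 0 + s *\<^sub>R d) w = 0"
      "u 1 = u 0 + s *\<^sub>R d"
    and second: "ud 2 \<in> tangent_space U\<^sub>0 B (2 *\<^sub>R u 1 - u 0)"
      "\<forall>w \<in> tangent_space U\<^sub>0 B (2 *\<^sub>R u 1 - u 0).
         ((ud 2 - d) /\<^sub>R s) \<bullet> w + \<alpha> / (2 * s) * (ud 2 \<bullet> w)
         + 1 / 3 * M (4 *\<^sub>R u 1 - u 0 + (2 * s) *\<^sub>R ud 2) w = 0"
      "u 2 = (4 *\<^sub>R u 1 - u 0 + (2 * s) *\<^sub>R ud 2) /\<^sub>R 3"
    and later: "\<And>n. n \<ge> 3 \<Longrightarrow> ud n \<in> tangent_space U\<^sub>0 B (2 *\<^sub>R u (n - 1) - u (n - 2)) \<and>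
         (\<forall>w \<in> tangent_space U\<^sub>0 B (2 *\<^sub>R u (n - 1) - u (n - 2)).
            ((ud n - ud (n - 1)) /\<^sub>R s) \<bullet> w + \<alpha> / (real n * s) * (ud n \<bullet> w)
            + 1 / 3 * M (4 *\<^sub>R u (n - 1) - u (n - 2) + (2 * s) *\<^sub>R ud n) w = 0) \<and>
         u n = (4 *\<^sub>R u (n - 1) - u (n - 2) + (2 * s) *\<^sub>R ud n) /\<^sub>R 3"
    using flow unfolding bdf2_accelerated_flow_def Let_def diff_zero by blast
  define v where "v n = (if n = 0 then d else ud (Suc n))" for n
  \<comment> \<open>With \<open>v 0 = d\<close> the second step is the general one at
    \<open>n = 0\<close>: its damping \<open>\<alpha> / (2 * s)\<close> is \<open>\<alpha>\<close>
    over the time of \<open>u 2\<close>.\<close>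
  have step: "v (Suc n) \<in> tangent_space U\<^sub>0 B (2 *\<^sub>R u (n + 1) - u n) \<and>
      (\<forall>w \<in> tangent_space U\<^sub>0 B (2 *\<^sub>R u (n + 1) - u n).
         ((v (Suc n) - v n) /\<^sub>R s) \<bullet> w + \<alpha> / (real (n + 2) * s) * (v (Suc n) \<bullet> w)
         + 1 / 3 * M (4 *\<^sub>R u (n + 1) - u n + (2 * s) *\<^sub>R v (Suc n)) w = 0) \<and>
      u (n + 2) = (4 *\<^sub>R u (n + 1) - u n + (2 * s) *\<^sub>R v (Suc n)) /\<^sub>R 3" for n
  proof (cases n)
    case 0
    then show ?thesis
      using second by (simp add: v_def numeral_2_eq_2)
  next
    case (Suc m)
    then show ?thesis
      using later[of "n + 2"] by (simp add: v_def numeral_2_eq_2)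
  qed
  \<comment> \<open>The argument of \<open>M\<close> in the scheme is three times the new iterate,
    which absorbs the factor 1/3.\<close>
  have M_scale: "M (u (n + 2)) w = 1 / 3 * M (4 *\<^sub>R u (n + 1) - u n + (2 * s) *\<^sub>R v (Suc n)) w" for n w
    using step[of n] symmetric_bilinear_expand(5)[OF M, of "inverse 3"] by simp
  show thesis
  proof
    show "B (2 *\<^sub>R u (n + 1) - u n) (v (Suc n)) = 0" for n
      using step[of n] by (simp add: tangent_space_def)
    show "(2 * s) *\<^sub>R v (Suc n) = 3 *\<^sub>R u (n + 2) - 4 *\<^sub>R u (n + 1) + u n" for n
      using step[of n] by simp
    show "((v (Suc n) - v n) /\<^sub>R s) \<bullet> v (Suc n)
        + \<alpha> / (real (n + 2) * s) * (v (Suc n) \<bullet> v (Suc n)) + M (u (n + 2)) (v (Suc n)) = 0" for n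
      unfolding M_scale using step[of n] by blast
  qed (use u0 first in \<open>auto simp: v_def tangent_space_def\<close>)
qed

section \<open>Propagation of the constraint defect\<close>

lemma bdf2_defect_bound:
  fixes B :: "'u :: real_inner \<Rightarrow> 'u \<Rightarrow> 'z :: real_normed_vector" and u v :: "nat \<Rightarrow> 'u"
  assumes B: "symmetric_bilinear B" and cZ: "\<And>x. norm (B x x) \<le> c * (norm x)\<^sup>2" "c \<ge> 0"
    and s: "s > 0"
    and u0: "B (u 0) (u 0) = u\<^sub>c" "B (u 0) (v 0) = 0" "u 1 = u 0 + s *\<^sub>R v 0"
    and tangent: "\<And>n. B (2 *\<^sub>R u (n + 1) - u n) (v (Suc n)) = 0"
    and vel: "\<And>n. (2 * s) *\<^sub>R v (Suc n) = 3 *\<^sub>R u (n + 2) - 4 *\<^sub>R u (n + 1) + u n"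
    and E: "(norm (v 0))\<^sup>2 \<le> E" "\<And>n. (\<Sum>k<n. (norm (v (Suc k) - v k))\<^sup>2) \<le> E"
  shows "norm (B (u n) (u n) - u\<^sub>c) \<le> 4 * c * E * s\<^sup>2"
proof -
  define q where "q n = B (u n) (u n) - u\<^sub>c" for n
  \<comment> \<open>Here \<open>\<delta> n\<close> is centred at \<open>u n\<close>. The value 0 at
    the start corresponds to a ghost iterate \<open>u 0 - s *\<^sub>R v 0\<close> before
    \<open>u 0\<close>, and makes the recurrence \<open>rec\<close> hold from \<open>n = 0\<close>
    on.\<close>
  define \<delta> where "\<delta> n = (if n = 0 then 0 else u (n + 1) - 2 *\<^sub>R u n + u (n - 1))" for n
  have \<delta>0: "\<delta> 0 = 0"
    by (simp add: \<delta>_def)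
  have q0: "q 0 = 0"
    by (simp add: q_def u0)
  \<comment> \<open>The first velocity is tangential at \<open>u 0\<close>, so the term linear in
    \<open>s\<close> vanishes.\<close>
  have q1: "q 1 = s\<^sup>2 *\<^sub>R B (v 0) (v 0)"
    using symmetric_bilinear_commute[OF B, of "v 0" "u 0"] u0
    by (simp add: q_def symmetric_bilinear_expand[OF B] power2_eq_square)
  have rec: "(2 * s) *\<^sub>R (v (Suc n) - v n) = 3 *\<^sub>R \<delta> (Suc n) - \<delta> n" for n
  proof (cases n)
    case 0
    have "(2 * s) *\<^sub>R v 0 = 2 *\<^sub>R (u 1 - u 0)"
      unfolding u0 by simp
    then show ?thesis
      using vel[of 0] 0 by (simp add: \<delta>_def scaleR_3_4 scaleR_2 numeral_2_eq_2 algebra_simps)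
  next
    case (Suc m)
    then show ?thesis
      using vel[of n] vel[of m] by (simp add: \<delta>_def scaleR_3_4 scaleR_2 algebra_simps)
  qed
  have sum_\<delta>: "(\<Sum>k<n. (norm (\<delta> (Suc k)))\<^sup>2) \<le> 8 / 7 * s\<^sup>2 * E" for n
  proof -
    have "7 * (\<Sum>k<n. (norm (\<delta> (Suc k)))\<^sup>2) \<le> 8 * s\<^sup>2 * (\<Sum>k<n. (norm (v (Suc k) - v k))\<^sup>2)"
      using sum_second_differences_bound[of \<delta> s "\<lambda>k. v (Suc k) - v k", OF \<delta>0 rec, of n]
        zero_le_power2[of "norm (\<delta> n)"] by linarith
    also have "\<dots> \<le> 8 * s\<^sup>2 * E"
      by (intro mult_left_mono E) simp
    finally show ?thesis
      by simp
  qed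
  have defect: "3 *\<^sub>R q (n + 2) - 4 *\<^sub>R q (n + 1) + q n = 3 *\<^sub>R B (\<delta> (Suc n)) (\<delta> (Suc n))" for n
  proof -
    have "B (2 *\<^sub>R u (n + 1) - u n) (3 *\<^sub>R u (n + 2) - 4 *\<^sub>R u (n + 1) + u n) = 0"
      unfolding vel[symmetric] by (simp add: symmetric_bilinear_expand(6)[OF B] tangent[simplified])
    from bdf2_defect_identity[OF B this] show ?thesis
      unfolding q_def by (simp add: \<delta>_def scaleR_3_4 algebra_simps)
  qed
  \<comment> \<open>The stencil 3, -4, 1 has characteristic roots 1 and 1/3. The root 1 is summed
    out here; the root 1/3 is left to \<open>linear_recurrence_bound\<close>.\<close>
  have telescope: "3 *\<^sub>R q (Suc n) - q n =
      3 *\<^sub>R (s\<^sup>2 *\<^sub>R B (v 0) (v 0) + (\<Sum>k<n. B (\<delta> (Suc k)) (\<delta> (Suc k))))" for n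
  proof (induction n)
    case 0
    show ?case
      using q0 q1 by simp
  next
    case (Suc n)
    have "3 *\<^sub>R q (Suc (Suc n)) - q (Suc n) =
        3 *\<^sub>R B (\<delta> (Suc n)) (\<delta> (Suc n)) + (3 *\<^sub>R q (Suc n) - q n)"
      using defect[of n] by (simp add: scaleR_3_4 algebra_simps)
    then show ?case
      unfolding Suc by (simp add: scaleR_add_right)
  qed
  \<comment> \<open>The constants add up to \<open>3 * (1 + 8 / 7) = 45 / 7\<close>, rounded up to
    8.\<close>
  have "norm (3 *\<^sub>R q (Suc n) - q n) \<le> 2 * (4 * c * E * s\<^sup>2)" for n
  proof -
    have "norm (s\<^sup>2 *\<^sub>R B (v 0) (v 0)) \<le> s\<^sup>2 * (c * E)"
      using order_trans[OF cZ(1) mult_left_mono[OF E(1) cZ(2)]] by (simp add: mult_left_mono)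
    moreover have "norm (\<Sum>k<n. B (\<delta> (Suc k)) (\<delta> (Suc k))) \<le> c * (8 / 7 * s\<^sup>2 * E)"
    proof -
      have "norm (\<Sum>k<n. B (\<delta> (Suc k)) (\<delta> (Suc k))) \<le> (\<Sum>k<n. c * (norm (\<delta> (Suc k)))\<^sup>2)"
        by (intro sum_norm_le cZ)
      also have "\<dots> \<le> c * (8 / 7 * s\<^sup>2 * E)"
        using mult_left_mono[OF sum_\<delta> cZ(2)] by (simp add: sum_distrib_left)
      finally show ?thesis .
    qed
    ultimately have "norm (s\<^sup>2 *\<^sub>R B (v 0) (v 0) + (\<Sum>k<n. B (\<delta> (Suc k)) (\<delta> (Suc k))))
        \<le> s\<^sup>2 * (c * E) + c * (8 / 7 * s\<^sup>2 * E)"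
      by (rule norm_triangle_mono)
    moreover have "c * E * s\<^sup>2 \<ge> 0"
      using cZ(2) order_trans[OF zero_le_power2 E(1)] by simp
    ultimately show ?thesis
      unfolding telescope by (simp add: mult_ac)
  qed
  from linear_recurrence_bound[of q, OF q0 this] show ?thesis
    by (simp add: q_def)
qed

section \<open>Constants independent of the step size\<close>

theorem theorem4p10:
  fixes \<Omega> \<Gamma>\<^sub>D :: "(real ^ 'd) set"
    and repU :: "'u :: {real_inner, complete_space} \<Rightarrow> real ^ 'd \<Rightarrow> real ^ 'm"
    and repZ :: "'z :: real_normed_vector \<Rightarrow> real ^ 'd \<Rightarrow> 'e :: euclidean_space"
    and T :: "'u \<Rightarrow> 'b :: real_vector" and g :: 'b
    and U\<^sub>D U\<^sub>0 :: "'u set"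
    and B :: "'u \<Rightarrow> 'u \<Rightarrow> 'z" and c\<^sub>Z :: real and u\<^sub>c :: 'z
    and M :: "'u \<Rightarrow> 'u \<Rightarrow> real" and C\<^sub>1 C\<^sub>2 :: real
    and \<alpha> :: real and u_init :: 'u
  assumes "bounded_lipschitz_domain \<Omega>"
    and "continuously_embedded_in_H1 \<Omega> repU"
    and "function_space_on \<Omega> repZ"
    and "\<Gamma>\<^sub>D \<subseteq> frontier \<Omega>"
    and "dirichlet_operator \<Omega> \<Gamma>\<^sub>D repU T"
    and "U\<^sub>D = {v. T v = g}"
    and "U\<^sub>0 = {v. T v = 0}"
    and "symmetric_bilinear B"
    and "\<And>v. norm (B v v) \<le> c\<^sub>Z * (norm v)\<^sup>2"
    and "symmetric_bilinear M"
    and "C\<^sub>1 > 0" and "C\<^sub>2 > 0"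
    and "\<And>v. M v v \<ge> C\<^sub>1 * (norm v)\<^sup>2"
    and "\<And>v w. M v w \<le> C\<^sub>2 * norm v * norm w"
    and "\<alpha> \<ge> 3"
    and "u_init \<in> admissible_set U\<^sub>D B u\<^sub>c"
  shows "\<exists>C > 0. \<forall>s > 0. \<forall>u. bdf2_accelerated_flow U\<^sub>0 B M \<alpha> s u_init u \<longrightarrow>
           (\<forall>N \<ge> 1. norm (B (u N) (u N) - u\<^sub>c) \<le> C * s\<^sup>2)"
proof -
  note M = \<open>symmetric_bilinear M\<close> and B = \<open>symmetric_bilinear B\<close>
  \<comment> \<open>\<open>K\<close> comes from the first velocity bounds, \<open>R\<close> bounds
    both \<open>u 1\<close> and the first extrapolation \<open>2 *\<^sub>R u 1 - u 0\<close>, and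
    \<open>E\<close> bounds the starting energy. None of them involves \<open>s\<close>.\<close>
  define K where "K = C\<^sub>2 * norm u_init"
  define R where "R = norm u_init + 2 * (K / C\<^sub>1)"
  define E where "E = K\<^sup>2 / C\<^sub>1 + C\<^sub>2 * R\<^sup>2"
  have nonneg: "K \<ge> 0" "K / C\<^sub>1 \<ge> 0" "R \<ge> 0" "E \<ge> 0"
    using \<open>C\<^sub>1 > 0\<close> \<open>C\<^sub>2 > 0\<close> by (simp_all add: K_def R_def E_def)
  have M_nonneg: "M x x \<ge> 0" for x
    using assms(13)[of x] \<open>C\<^sub>1 > 0\<close> by (meson mult_nonneg_nonneg less_imp_le order_trans zero_le_power2)
  have M_le: "M x x \<le> C\<^sub>2 * R\<^sup>2" if "norm x \<le> R" for x
  proof -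
    have "M x x \<le> C\<^sub>2 * (norm x)\<^sup>2"
      using assms(14)[of x x] by (simp add: power2_eq_square)
    also have "\<dots> \<le> C\<^sub>2 * R\<^sup>2"
      using that \<open>C\<^sub>2 > 0\<close> by (intro mult_left_mono power_mono) auto
    finally show ?thesis .
  qed
  \<comment> \<open>The sign of \<open>c\<^sub>Z\<close> is not prescribed; the absolute value
    supplies the nonnegative constant for \<open>bdf2_defect_bound\<close>.\<close>
  have cZ: "norm (B x x) \<le> \<bar>c\<^sub>Z\<bar> * (norm x)\<^sup>2" for x
    by (rule order_trans[OF assms(9)]) (simp add: mult_right_mono)
  have bound: "norm (B (u n) (u n) - u\<^sub>c) \<le> 4 * \<bar>c\<^sub>Z\<bar> * E * s\<^sup>2"
    if s: "s > 0" and flow: "bdf2_accelerated_flow U\<^sub>0 B M \<alpha> s u_init u" for s u n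
  proof -
    obtain v where u0: "u 0 = u_init" "B u_init (v 0) = 0" "u 1 = u_init + s *\<^sub>R v 0"
      and first: "(v 0 /\<^sub>R s) \<bullet> v 0 + \<alpha> / s * (v 0 \<bullet> v 0) + M (u_init + s *\<^sub>R v 0) (v 0) = 0"
      and tangent: "\<And>n. B (2 *\<^sub>R u (n + 1) - u n) (v (Suc n)) = 0"
      and vel: "\<And>n. (2 * s) *\<^sub>R v (Suc n) = 3 *\<^sub>R u (n + 2) - 4 *\<^sub>R u (n + 1) + u n"
      and eq: "\<And>n. ((v (Suc n) - v n) /\<^sub>R s) \<bullet> v (Suc n)
        + \<alpha> / (real (n + 2) * s) * (v (Suc n) \<bullet> v (Suc n)) + M (u (n + 2)) (v (Suc n)) = 0"
      using bdf2_accelerated_flow_velocity[OF flow M] by metis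
    have v0: "norm (v 0) \<le> K * s" "s * norm (v 0) \<le> K / C\<^sub>1"
      unfolding K_def
      by (rule first_velocity_bounds[OF M assms(11) assms(13) assms(14) assms(12) _ s first];
          use \<open>\<alpha> \<ge> 3\<close> in simp)+
    \<comment> \<open>Multiplying the two bounds on \<open>v 0\<close> produces one factor
      \<open>s\<close> on each side, which cancels.\<close>
    have "s * (norm (v 0))\<^sup>2 = norm (v 0) * (s * norm (v 0))"
      by (simp add: power2_eq_square)
    also have "\<dots> \<le> (K * s) * (K / C\<^sub>1)"
      using v0 s nonneg by (intro mult_mono) auto
    also have "\<dots> = s * (K\<^sup>2 / C\<^sub>1)"
      by (simp add: power2_eq_square)
    finally have v0_sq: "(norm (v 0))\<^sup>2 \<le> K\<^sup>2 / C\<^sub>1"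
      by (rule mult_left_le_imp_le) (rule s)
    have "norm (u 1) \<le> norm u_init + s * norm (v 0)"
      using norm_triangle_ineq[of u_init "s *\<^sub>R v 0"] s unfolding u0 by simp
    then have u1: "norm (u 1) \<le> R"
      using v0(2) nonneg by (simp add: R_def)
    have "2 *\<^sub>R u 1 - u 0 = u_init + (2 * s) *\<^sub>R v 0"
      unfolding u0 by (simp add: scaleR_add_right scaleR_2)
    then have "norm (2 *\<^sub>R u 1 - u 0) \<le> norm u_init + 2 * (s * norm (v 0))"
      using norm_triangle_ineq[of u_init "(2 * s) *\<^sub>R v 0"] s by simp
    then have uh: "norm (2 *\<^sub>R u 1 - u 0) \<le> R"
      using v0(2) by (simp add: R_def)
    have "(\<Sum>k<n. (norm (v (Suc k) - v k))\<^sup>2)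
        \<le> (norm (v 0))\<^sup>2 + (M (u 1) (u 1) + M (2 *\<^sub>R u 1 - u 0) (2 *\<^sub>R u 1 - u 0)) / 2" for n
      by (rule bdf2_velocity_energy_estimate[OF M M_nonneg s _ vel eq])
        (use s \<open>\<alpha> \<ge> 3\<close> in simp)
    also have "\<dots> \<le> E"
      using v0_sq M_le[OF u1] M_le[OF uh] unfolding E_def add_divide_distrib by linarith
    finally have sum: "(\<Sum>k<n. (norm (v (Suc k) - v k))\<^sup>2) \<le> E" for n .
    have "(norm (v 0))\<^sup>2 \<le> E"
      using v0_sq \<open>C\<^sub>2 > 0\<close> by (simp add: E_def add_increasing2)
    then show ?thesis
      using assms(16) u0
      by (intro bdf2_defect_bound[OF B cZ _ s _ _ _ tangent vel _ sum])
        (simp_all add: admissible_set_def)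
  qed
  \<comment> \<open>The summand 1 keeps the constant positive even if \<open>c\<^sub>Z\<close> or
    \<open>E\<close> is zero.\<close>
  have "4 * \<bar>c\<^sub>Z\<bar> * E + 1 > 0"
    using nonneg by (simp add: add_nonneg_pos)
  moreover have "norm (B (u n) (u n) - u\<^sub>c) \<le> (4 * \<bar>c\<^sub>Z\<bar> * E + 1) * s\<^sup>2"
    if "s > 0" "bdf2_accelerated_flow U\<^sub>0 B M \<alpha> s u_init u" for s u n
    using bound[OF that] by (simp add: distrib_right add_increasing2)
  ultimately show ?thesis
    by blast
qed

end
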